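(* Let $m$ be a squarefree integer of the form $m=2\cdot(\text{odd})$, and consider the residues modulo $m$ under multiplication. Then: (a) each even idempotent $e$ has $e+1\in G_1$; (b) each odd idempotent $d$ has $d+1\in G_2$; (c) for each even idempotent $e$, if $n$ is the period of $e+1$ in $G_1$, then $e\,(2^n-1)\equiv 0 \pmod m$.
   Context: An idempotent is a residue $e$ modulo $m$ with $e^2\equiv e\pmod m$. Since $m$ is even, parity of a residue modulo $m$ is well defined. For a divisor $d$ of $m$, $G_d$ is the set of residues $n$ modulo $m$ with $\gcd(n,m)=d$ (with $\gcd(0,m)=m$), which is a group under multiplication modulo $m$. In particular $G_1$ is the group of units modulo $m$, and $G_2$ is the set of residues $n$ with $\gcd(n,m)=2$. The period of an element of $G_1$ is its multiplicative order modulo $m$. *)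

theory Defs
  imports "HOL-Number_Theory.Number_Theory" "HOL-Computational_Algebra.Squarefree"
begin

text \<open>Residues modulo \<open>m\<close> are represented by their canonical representatives in
  \<open>{..<m}\<close>.  For even \<open>m\<close> the parity of a residue is the parity of any representative, so
  \<open>even\<close> and \<open>odd\<close> can be used directly.\<close>

definition idempotents_mod :: "nat \<Rightarrow> nat set"
  where "idempotents_mod m = {e. e < m \<and> [e\<^sup>2 = e] (mod m)}"

text \<open>The convention \<open>gcd 0 m = m\<close> is that of the library.\<close>

definition G :: "nat \<Rightarrow> nat \<Rightarrow> nat set"
  where "G m d = {n. n < m \<and> gcd n m = d}"

end

theory Submission
  imports Defs
begin

text \<open>An idempotent \<open>e\<close> satisfies \<open>e (e + 1) = 2 e\<close> modulo \<open>m\<close>. Hence every common divisor of \<open>e + 1\<close>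
  and \<open>m\<close> divides \<open>2 e\<close>, and so \<open>2 (e + 1) - 2 e = 2\<close>; parity then decides between \<open>1\<close> and \<open>2\<close>.
  Iterating the same congruence gives \<open>e (e + 1)\<^sup>n = 2\<^sup>n e\<close>.\<close>

lemma idempotent_cong_mult_Suc:
  fixes e m :: nat
  assumes "[e\<^sup>2 = e] (mod m)"
  shows "[e * (e + 1) = 2 * e] (mod m)"
  using cong_add[OF assms cong_refl[of e m]]
  by (simp add: power2_eq_square algebra_simps flip: mult_2_right)

lemma gcd_Suc_idempotent_dvd_2:
  fixes e m :: nat
  assumes "[e\<^sup>2 = e] (mod m)"
  shows "gcd (e + 1) m dvd 2"
proof -
  \<comment> \<open>The congruence survives modulo a divisor of \<open>m\<close>; modulo this one
    \<open>e + 1\<close> vanishes, hence so does \<open>2 * e\<close>.\<close>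
  have "[e * (e + 1) = 2 * e] (mod gcd (e + 1) m)"
    using idempotent_cong_mult_Suc[OF assms] by (rule cong_dvd_mono_modulus) simp
  hence "gcd (e + 1) m dvd 2 * e"
    by (rule cong_dvd_iff[THEN iffD1]) (intro dvd_mult gcd_dvd1)
  moreover have "gcd (e + 1) m dvd 2 * e + 2"
    using dvd_mult[of "gcd (e + 1) m" "e + 1" 2] by simp
  ultimately show ?thesis
    by (rule dvd_add_right_iff[THEN iffD1])
qed

lemma gcd_Suc_even_idempotent:
  fixes e m :: nat
  assumes "[e\<^sup>2 = e] (mod m)" and "even e"
  shows "gcd (e + 1) m = 1"
proof -
  have "odd (gcd (e + 1) m)"
    using assms(2) by simp
  moreover have "gcd (e + 1) m \<in> {1, 2}"
    using gcd_Suc_idempotent_dvd_2[OF assms(1)] prime_nat_iff[of 2] two_is_prime_nat by blast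
  ultimately show ?thesis
    by (metis empty_iff even_numeral even_Suc insertE numeral_2_eq_2 odd_one)
qed

text \<open>Both \<open>d + 1\<close> and \<open>m\<close> are even, so 2 divides the gcd, which in
  turn divides 2.\<close>

lemma gcd_Suc_odd_idempotent:
  fixes d m :: nat
  assumes "[d\<^sup>2 = d] (mod m)" and "odd d" and "even m"
  shows "gcd (d + 1) m = 2"
  using gcd_Suc_idempotent_dvd_2[OF assms(1)] assms(2,3) by (intro dvd_antisym) simp_all

lemma idempotent_cong_mult_Suc_power:
  fixes e m n :: nat
  assumes "[e\<^sup>2 = e] (mod m)"
  shows "[e * (e + 1) ^ n = e * 2 ^ n] (mod m)"
proof (induction n)
  case (Suc n)
  have "[e * (e + 1) ^ n * (e + 1) = e * 2 ^ n * (e + 1)] (mod m)"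
    using Suc.IH by (rule cong_mult) simp
  \<comment> \<open>The new factor \<open>e + 1\<close> is moved next to \<open>e\<close>, where it
    acts as 2.\<close>
  moreover have "[2 ^ n * (e * (e + 1)) = 2 ^ n * (2 * e)] (mod m)"
    by (rule cong_mult[OF cong_refl idempotent_cong_mult_Suc[OF assms]])
  ultimately have "[e * (e + 1) ^ n * (e + 1) = 2 ^ n * (2 * e)] (mod m)"
    by (metis cong_trans mult.assoc mult.commute)
  thus ?case
    by (simp only: power_Suc ac_simps)
qed simp

lemma idempotent_cong_ord_Suc:
  fixes e m :: nat
  assumes "[e\<^sup>2 = e] (mod m)"
  shows "[int e * (2 ^ ord m (e + 1) - 1) = 0] (mod int m)"
proof -
  let ?n = "ord m (e + 1)"
  \<comment> \<open>This holds even if \<open>e + 1\<close> is not a unit: \<open>ord\<close> is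
    then 0 and the power is 1.\<close>
  have "[e * (e + 1) ^ ?n = e * 1] (mod m)"
    using ord by (intro cong_mult) simp_all
  with idempotent_cong_mult_Suc_power[OF assms] have "[e * 2 ^ ?n = e] (mod m)"
    by (metis cong_sym cong_trans mult_1_right)
  \<comment> \<open>Over the integers the two sides can be subtracted, which produces the factor
    \<open>2 ^ ?n - 1\<close>.\<close>
  hence "[int (e * 2 ^ ?n) = int e] (mod int m)"
    by (simp only: cong_int_iff)
  thus ?thesis
    by (simp add: cong_iff_dvd_diff algebra_simps)
qed

theorem lemma3p2:
  fixes m k :: nat
  assumes "squarefree m" and "m = 2 * k" and "odd k"
  shows "(\<forall>e \<in> idempotents_mod m. even e \<longrightarrow> (e + 1) mod m \<in> G m 1) \<and>
    (\<forall>d \<in> idempotents_mod m. odd d \<longrightarrow> (d + 1) mod m \<in> G m 2) \<and>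
    (\<forall>e \<in> idempotents_mod m. even e \<longrightarrow>
      (\<forall>n. n = ord m ((e + 1) mod m) \<longrightarrow> [int e * (2 ^ n - 1) = 0] (mod (int m))))"
proof (intro conjI ballI impI allI)
  have m: "m > 0" "even m"
    using assms by (auto intro: odd_pos)
  \<comment> \<open>This covers the case where \<open>e + 1\<close> wraps around to 0, which happens
    for \<open>m = 2\<close> and \<open>e = 1\<close>; there \<open>gcd 0 2 = 2\<close>.\<close>
  have gcd_mod: "gcd (a mod m) m = gcd a m" for a
    by (metis gcd.commute gcd_red_nat)
  fix e assume "e \<in> idempotents_mod m"
  hence e: "[e\<^sup>2 = e] (mod m)"
    by (simp add: idempotents_mod_def)
  show "(e + 1) mod m \<in> G m 1" if "even e"
    using gcd_Suc_even_idempotent[OF e that] m by (simp add: G_def gcd_mod)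
  show "(e + 1) mod m \<in> G m 2" if "odd e"
    using gcd_Suc_odd_idempotent[OF e that] m by (simp add: G_def gcd_mod)
  show "[int e * (2 ^ n - 1) = 0] (mod int m)" if "n = ord m ((e + 1) mod m)" for n
  proof -
    have "n = ord m (e + 1)"
      unfolding that by (rule ord_cong) simp
    thus ?thesis
      using idempotent_cong_ord_Suc[OF e] by simp
  qed
qed

end
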